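(* There is a universal constant $c>0$ such that the following holds. Let $\mu$ be a probability distribution supported on $\Omega=\{\pm1\}^n$ and $\{q_i:\Omega\to\mathbb{R}_+\}_{i\in[n]}$ be transition rates reversible for $\mu$. Let $\{w_i:\Omega\to\mathbb{R}_+\}_{i\in[n]}$ be weight functions that are $b$-bounded for some $b\in(0,1]$. Suppose that the reinforced Bakry–Émery condition (equivalently, the strong gradient estimate) holds with constant $\rho_{\mathrm{rBE}}\in\mathbb{R}$, and that the log-Sobolev inequality holds with constant $\rho_{\mathrm{LSI}}>0$. Then for any $f:\Omega\to\{0,1\}$, $$A_w(f)\ge c\,\frac{\sqrt b\,\rho_{\mathrm{LSI}}}{\sqrt{\rho_{\mathrm{LSI}}+\kappa}}\;\mathrm{Var}_\mu(f)\sqrt{\log\frac{e}{\mathrm{Var}_\mu(f)}},\qquad \kappa=\max\{0,-\rho_{\mathrm{rBE}}\}.$$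
   Context: $x^i$ is $x\in\Omega$ with the $i$-th coordinate flipped. Generator: $Lf(x)=\sum_{i=1}^nq_i(x)(f(x^i)-f(x))$; $P_t=e^{tL}$. Reversible for $\mu$: $\mu(x)q_i(x)=\mu(x^i)q_i(x^i)$ for all $x,i$. $b$-bounded weights: $b\le w_i(x)\le1/b$ for all $x,i$. $\Gamma_w(f,g)(x)=\frac12\sum_{i=1}^nw_i(x)q_i(x)(f(x^i)-f(x))(g(x^i)-g(x))$, $\Gamma_w(f)=\Gamma_w(f,f)$; $\Gamma$ is $\Gamma_w$ with $w\equiv1$; $\Gamma_{2;w}(f)=\frac12L\Gamma_w(f)-\Gamma_w(f,Lf)$. Surface area: $A_w(f)=\mathbb{E}_\mu[\sqrt{\Gamma_w(f)}]$. Reinforced Bakry–Émery condition with constant $\rho$: $\Gamma_{2;w}(f)-\Gamma(\sqrt{\Gamma_w(f)})\ge\rho\,\Gamma_w(f)$ pointwise for all $f:\Omega\to\mathbb{R}$. Strong gradient estimate with constant $\rho$: $\sqrt{\Gamma_w(P_tf)}\le e^{-\rho t}P_t\sqrt{\Gamma_w(f)}$ pointwise for all $f:\Omega\to\mathbb{R}$, $t\ge0$. The two are equivalent. Log-Sobolev inequality with constant $\rho$: $\mathrm{Ent}_\mu[f^2]\le\frac2\rho\mathbb{E}_\mu[\Gamma(f)]$ for all $f:\Omega\to\mathbb{R}$, where $\mathrm{Ent}_\mu[g]=\mathbb{E}_\mu[g\log g]-\mathbb{E}_\mu[g]\log\mathbb{E}_\mu[g]$. $\log$ is natural. The right-hand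 side of the conclusion is $0$ when $\mathrm{Var}_\mu(f)=0$. *)

theory Defs
  imports "HOL-Probability.Probability"
begin

text \<open>
  The dimension n is an explicit natural number (not a type), so that one constant can serve all
  dimensions. Real functions on the cube are total functions on \<^typ>\<open>nat \<Rightarrow> int\<close>; only their
  values on the cube matter, since flipping a coordinate \<open>i \<in> {1..n}\<close> maps the cube to itself.
\<close>

definition cube :: "nat \<Rightarrow> (nat \<Rightarrow> int) set" where
  "cube n = {1..n} \<rightarrow>\<^sub>E {-1, 1}"

definition flip :: "(nat \<Rightarrow> int) \<Rightarrow> nat \<Rightarrow> (nat \<Rightarrow> int)" where
  "flip x i = x(i := - x i)"

definition gen ::
  "nat \<Rightarrow> (nat \<Rightarrow> (nat \<Rightarrow> int) \<Rightarrow> real) \<Rightarrow> ((nat \<Rightarrow> int) \<Rightarrow> real) \<Rightarrow> (nat \<Rightarrow> int) \<Rightarrow> real" where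
  "gen n q f x = (\<Sum>i\<in>{1..n}. q i x * (f (flip x i) - f x))"

text \<open>The operator exponential \<open>P\<^sub>t = exp (t L)\<close> as its power series.\<close>

definition semigroup_at ::
  "nat \<Rightarrow> (nat \<Rightarrow> (nat \<Rightarrow> int) \<Rightarrow> real) \<Rightarrow> real \<Rightarrow> ((nat \<Rightarrow> int) \<Rightarrow> real) \<Rightarrow> (nat \<Rightarrow> int) \<Rightarrow> real" where
  "semigroup_at n q t f x = (\<Sum>k. t ^ k / fact k * (gen n q ^^ k) f x)"

definition transition_rates :: "nat \<Rightarrow> (nat \<Rightarrow> (nat \<Rightarrow> int) \<Rightarrow> real) \<Rightarrow> bool" where
  "transition_rates n q \<longleftrightarrow> (\<forall>i\<in>{1..n}. \<forall>x\<in>cube n. 0 \<le> q i x)"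

definition reversible ::
  "nat \<Rightarrow> (nat \<Rightarrow> int) pmf \<Rightarrow> (nat \<Rightarrow> (nat \<Rightarrow> int) \<Rightarrow> real) \<Rightarrow> bool" where
  "reversible n \<mu> q \<longleftrightarrow>
     (\<forall>i\<in>{1..n}. \<forall>x\<in>cube n. pmf \<mu> x * q i x = pmf \<mu> (flip x i) * q i (flip x i))"

definition bounded_weights :: "nat \<Rightarrow> real \<Rightarrow> (nat \<Rightarrow> (nat \<Rightarrow> int) \<Rightarrow> real) \<Rightarrow> bool" where
  "bounded_weights n b w \<longleftrightarrow> (\<forall>i\<in>{1..n}. \<forall>x\<in>cube n. b \<le> w i x \<and> w i x \<le> 1 / b)"

definition Gamma_bi ::
  "nat \<Rightarrow> (nat \<Rightarrow> (nat \<Rightarrow> int) \<Rightarrow> real) \<Rightarrow> (nat \<Rightarrow> (nat \<Rightarrow> int) \<Rightarrow> real) \<Rightarrow>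
   ((nat \<Rightarrow> int) \<Rightarrow> real) \<Rightarrow> ((nat \<Rightarrow> int) \<Rightarrow> real) \<Rightarrow> (nat \<Rightarrow> int) \<Rightarrow> real" where
  "Gamma_bi n q w f g x =
     1 / 2 * (\<Sum>i\<in>{1..n}. w i x * q i x * (f (flip x i) - f x) * (g (flip x i) - g x))"

definition Gamma_w ::
  "nat \<Rightarrow> (nat \<Rightarrow> (nat \<Rightarrow> int) \<Rightarrow> real) \<Rightarrow> (nat \<Rightarrow> (nat \<Rightarrow> int) \<Rightarrow> real) \<Rightarrow>
   ((nat \<Rightarrow> int) \<Rightarrow> real) \<Rightarrow> (nat \<Rightarrow> int) \<Rightarrow> real" where
  "Gamma_w n q w f = Gamma_bi n q w f f"

definition Gamma ::
  "nat \<Rightarrow> (nat \<Rightarrow> (nat \<Rightarrow> int) \<Rightarrow> real) \<Rightarrow> ((nat \<Rightarrow> int) \<Rightarrow> real) \<Rightarrow> (nat \<Rightarrow> int) \<Rightarrow> real" where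
  "Gamma n q f = Gamma_w n q (\<lambda>i x. 1) f"

definition Gamma2_w ::
  "nat \<Rightarrow> (nat \<Rightarrow> (nat \<Rightarrow> int) \<Rightarrow> real) \<Rightarrow> (nat \<Rightarrow> (nat \<Rightarrow> int) \<Rightarrow> real) \<Rightarrow>
   ((nat \<Rightarrow> int) \<Rightarrow> real) \<Rightarrow> (nat \<Rightarrow> int) \<Rightarrow> real" where
  "Gamma2_w n q w f x =
     1 / 2 * gen n q (Gamma_w n q w f) x - Gamma_bi n q w f (gen n q f) x"

definition surface_area ::
  "nat \<Rightarrow> (nat \<Rightarrow> int) pmf \<Rightarrow> (nat \<Rightarrow> (nat \<Rightarrow> int) \<Rightarrow> real) \<Rightarrow> (nat \<Rightarrow> (nat \<Rightarrow> int) \<Rightarrow> real) \<Rightarrow>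
   ((nat \<Rightarrow> int) \<Rightarrow> real) \<Rightarrow> real" where
  "surface_area n \<mu> q w f = measure_pmf.expectation \<mu> (\<lambda>x. sqrt (Gamma_w n q w f x))"

definition reinforced_BE ::
  "nat \<Rightarrow> (nat \<Rightarrow> (nat \<Rightarrow> int) \<Rightarrow> real) \<Rightarrow> (nat \<Rightarrow> (nat \<Rightarrow> int) \<Rightarrow> real) \<Rightarrow> real \<Rightarrow> bool" where
  "reinforced_BE n q w \<rho> \<longleftrightarrow>
     (\<forall>f. \<forall>x\<in>cube n.
        Gamma2_w n q w f x - Gamma n q (\<lambda>y. sqrt (Gamma_w n q w f y)) x
          \<ge> \<rho> * Gamma_w n q w f x)"

definition strong_gradient_estimate ::
  "nat \<Rightarrow> (nat \<Rightarrow> (nat \<Rightarrow> int) \<Rightarrow> real) \<Rightarrow> (nat \<Rightarrow> (nat \<Rightarrow> int) \<Rightarrow> real) \<Rightarrow> real \<Rightarrow> bool" where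
  "strong_gradient_estimate n q w \<rho> \<longleftrightarrow>
     (\<forall>f. \<forall>t\<ge>0. \<forall>x\<in>cube n.
        sqrt (Gamma_w n q w (semigroup_at n q t f) x)
          \<le> exp (- \<rho> * t) * semigroup_at n q t (\<lambda>y. sqrt (Gamma_w n q w f y)) x)"

text \<open>The convention \<open>0 log 0 = 0\<close> holds automatically.\<close>

definition Ent :: "(nat \<Rightarrow> int) pmf \<Rightarrow> ((nat \<Rightarrow> int) \<Rightarrow> real) \<Rightarrow> real" where
  "Ent \<mu> g = measure_pmf.expectation \<mu> (\<lambda>x. g x * ln (g x))
             - measure_pmf.expectation \<mu> g * ln (measure_pmf.expectation \<mu> g)"

definition log_Sobolev ::
  "nat \<Rightarrow> (nat \<Rightarrow> int) pmf \<Rightarrow> (nat \<Rightarrow> (nat \<Rightarrow> int) \<Rightarrow> real) \<Rightarrow> real \<Rightarrow> bool" where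
  "log_Sobolev n \<mu> q \<rho> \<longleftrightarrow>
     (\<forall>f. Ent \<mu> (\<lambda>x. (f x)\<^sup>2) \<le> 2 / \<rho> * measure_pmf.expectation \<mu> (Gamma n q f))"

end

theory Submission
  imports Defs
begin

text \<open>
  Let \<open>u\<^sub>t = P\<^sub>t f\<close>. Everything is read off from the energy drop
  \<open>E[f\<^sup>2] - E[u\<^sub>t\<^sup>2]\<close>, which the curvature condition bounds from above by the surface area and
  the log-Sobolev inequality bounds from below; the two bounds are then compared at a good time \<open>t\<close>.

  \<^bold>\<open>Upper bound\<close> (\<open>energy_drop_le\<close>, \<open>energy_drop_le_surface_area\<close>).
  The energy decreases at rate \<open>2 E[\<Gamma>(u\<^sub>t)]\<close>, and the gradient estimate gives
  \<open>\<Gamma>(u\<^sub>t) \<le> \<Gamma>\<^sub>w(u\<^sub>t) / b \<le> exp (2 \<kappa> t) v\<^sub>t\<^sup>2 / b\<close> for \<open>v\<^sub>t = P\<^sub>t (\<surd>(\<Gamma>\<^sub>w f))\<close>.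
  Only \<open>E[v\<^sub>t] = A\<^sub>w(f)\<close> is under control, not \<open>E[v\<^sub>t\<^sup>2]\<close>, so the places where \<open>v\<^sub>t\<close> is large need
  another argument. In terms of the martingales \<open>u(X)\<close> and \<open>v(X)\<close> along the chain, one would stop
  when \<open>v\<close> exceeds a level: this is unlikely by Doob's inequality, and after stopping the variance
  of a Boolean variable is at most \<open>1/4\<close>. Analytically, stopping is replaced by the Bellman function
  \<open>B(m,k) = m (1 - m) k / (m (1 - m) + k)\<close>, a smooth version of the minimum of \<open>m (1 - m)\<close> and \<open>k\<close>.
  It is concave, at most \<open>k\<close>, and where \<open>k\<close> is large it behaves like \<open>m (1 - m)\<close>, so that
  \<open>E[B(u\<^sub>t, v\<^sub>t)]\<close> grows at almost the rate at which the energy is lost.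
  Applied to \<open>v\<close> rescaled by \<open>\<surd>(t / b)\<close> this bounds the drop by
  \<open>(1 + exp (2 \<kappa> t)) \<surd>(t / b) A\<^sub>w(f)\<close>. Here the bound on the weights enters only through \<open>\<Gamma> \<le> \<Gamma>\<^sub>w / b\<close>, once and
  under a square root, which is why the final inequality loses no more than \<open>\<surd>b\<close>.

  \<^bold>\<open>Lower bound\<close> (\<open>energy_decay\<close>, \<open>energy_drop_ge\<close>).
  With \<open>a = E[f]\<close> and \<open>y = E[u\<^sub>t\<^sup>2]\<close>, Jensen's inequality gives
  \<open>Ent (u\<^sub>t\<^sup>2) \<ge> y log (y / a\<^sup>2)\<close>, so the log-Sobolev inequality is a differential inequality for \<open>y\<close>
  alone. Solving it yields \<open>y \<le> a \<cdot> a powr (1 - exp (- \<rho> t))\<close>, and the drop is at least a constant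
  times \<open>Var(f) \<rho> t log (e / Var(f))\<close> as long as \<open>\<rho> t log (e / Var(f)) \<le> 1\<close>.

  The choice \<open>t = 1 / (\<rho> log (e / Var(f)) + \<kappa>)\<close> keeps \<open>exp (2 \<kappa> t)\<close> bounded and gives the theorem.
  The reinforced Bakry-Emery condition enters only through the gradient estimate, which a maximum
  principle on the finite cube derives from it (\<open>gradient_bound_of_reinforced_BE\<close>).
\<close>

section \<open>The cube and a finite maximum principle\<close>

lemma finite_cube: "finite (cube n)"
  unfolding cube_def by (intro finite_PiE) auto

lemma flip_in_cube: "i \<in> {1..n} \<Longrightarrow> x \<in> cube n \<Longrightarrow> flip x i \<in> cube n"
  unfolding cube_def flip_def by (auto simp: PiE_iff extensional_def)

lemma flip_flip: "flip (flip x i) i = x"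
  unfolding flip_def by auto

lemma gen_cong:
  assumes "\<And>y. y \<in> cube n \<Longrightarrow> f y = g y" "x \<in> cube n"
  shows "gen n q f x = gen n q g x"
  unfolding gen_def using assms flip_in_cube by (intro sum.cong refl) auto

lemma gen_affine: "gen n q (\<lambda>y. c * h y + d) x = c * gen n q h x"
  unfolding gen_def by (simp add: sum_distrib_left algebra_simps)

lemma gen_diff: "gen n q (\<lambda>y. h y - k y) x = gen n q h x - gen n q k x"
  unfolding gen_def by (simp add: sum_subtractf [symmetric] algebra_simps)

text \<open>
  The maximum principle in the form in which all comparisons below use it: at the first time at which
  one of finitely many continuous functions reaches zero, that function arrives from below, so it
  cannot have a negative derivative there. The step hypothesis only has to be checked at a maximum
  point over \<open>X\<close>.
\<close>

lemma first_crossing: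
  fixes \<phi> :: "real \<Rightarrow> 'a \<Rightarrow> real"
  assumes fin: "finite X"
    and cont: "\<And>x. x \<in> X \<Longrightarrow> continuous_on {0..T} (\<lambda>r. \<phi> r x)"
    and init: "\<And>x. x \<in> X \<Longrightarrow> \<phi> 0 x < 0"
    and step: "\<And>r x. 0 < r \<Longrightarrow> r \<le> T \<Longrightarrow> x \<in> X \<Longrightarrow> \<phi> r x = 0 \<Longrightarrow> \<forall>y\<in>X. \<phi> r y \<le> 0 \<Longrightarrow>
            \<exists>D<0. ((\<lambda>s. \<phi> s x) has_real_derivative D) (at r)"
    and r: "0 \<le> r" "r \<le> T" and x: "x \<in> X"
  shows "\<phi> r x < 0"
proof (rule ccontr)
  assume neg: "\<not> \<phi> r x < 0"
  define S where "S = (\<Union>y\<in>X. {s\<in>{0..T}. 0 \<le> \<phi> s y})"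
  have "compact S" unfolding S_def
  proof (rule compact_UN [OF fin])
    fix y assume "y \<in> X"
    hence "closed ({0..T} \<inter> (\<lambda>s. \<phi> s y) -` {0..})"
      by (intro continuous_closed_preimage cont) auto
    moreover have "{0..T} \<inter> (\<lambda>s. \<phi> s y) -` {0..} = {s\<in>{0..T}. 0 \<le> \<phi> s y}" by auto
    moreover have "bounded {s\<in>{0..T}. 0 \<le> \<phi> s y}"
      by (rule bounded_subset [OF bounded_closed_interval [of 0 T]]) auto
    ultimately show "compact {s\<in>{0..T}. 0 \<le> \<phi> s y}"
      by (simp add: compact_eq_bounded_closed)
  qed
  moreover have "r \<in> S" unfolding S_def using neg r by (intro UN_I [OF x]) auto
  ultimately obtain s where sS: "s \<in> S" and smin: "\<And>t. t \<in> S \<Longrightarrow> s \<le> t"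
    using compact_attains_inf [of S] by blast
  obtain y where y: "y \<in> X" "0 \<le> \<phi> s y" and s: "0 \<le> s" "s \<le> T"
    using sS unfolding S_def by auto
  have "s \<noteq> 0" using init y by force
  hence s0: "0 < s" using s by simp
  have before: "\<phi> t z < 0" if "0 \<le> t" "t < s" "z \<in> X" for t z
    using smin [of t] that s unfolding S_def by (force simp: not_le)
  have atmost: "\<phi> s z \<le> 0" if zX: "z \<in> X" for z
  proof (rule ccontr)
    assume "\<not> \<phi> s z \<le> 0"
    moreover have "continuous_on {0..s} (\<lambda>r. \<phi> r z)"
      using cont [OF zX] by (rule continuous_on_subset) (use s in auto)
    ultimately obtain t where t: "0 \<le> t" "t \<le> s" "\<phi> t z = 0"
      using IVT' [of "\<lambda>r. \<phi> r z" 0 0 s] init [OF zX] s by auto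
    thus False using before [of t z] zX \<open>\<not> \<phi> s z \<le> 0\<close> by (cases "t = s") auto
  qed
  have "\<phi> s y = 0" using atmost y by force
  then obtain D where "D < 0" "((\<lambda>t. \<phi> t y) has_real_derivative D) (at s)"
    using step [OF s0 s(2) y(1)] atmost by auto
  then obtain d where d: "d > 0" "\<And>h. h > 0 \<Longrightarrow> h < d \<Longrightarrow> \<phi> s y < \<phi> (s - h) y"
    using DERIV_neg_dec_left by blast
  define h where "h = min (d / 2) s"
  have "\<phi> s y < \<phi> (s - h) y" using d s0 by (intro d(2)) (auto simp: h_def)
  moreover have "\<phi> (s - h) y < 0" using before [of "s - h" y] s0 d y by (auto simp: h_def)
  ultimately show False using y by simp
qed

section \<open>Reversible chains and heat flows\<close>

locale cube_chain =
  fixes n :: nat and \<mu> :: "(nat \<Rightarrow> int) pmf" and q :: "nat \<Rightarrow> (nat \<Rightarrow> int) \<Rightarrow> real"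
  assumes supp: "set_pmf \<mu> \<subseteq> cube n"
    and rates: "transition_rates n q"
    and rev: "reversible n \<mu> q"
begin

lemma q_nonneg: "i \<in> {1..n} \<Longrightarrow> x \<in> cube n \<Longrightarrow> 0 \<le> q i x"
  using rates unfolding transition_rates_def by auto

definition mean :: "((nat \<Rightarrow> int) \<Rightarrow> real) \<Rightarrow> real" where
  "mean g = (\<Sum>x\<in>cube n. pmf \<mu> x * g x)"

lemma expectation_eq_mean: "measure_pmf.expectation \<mu> g = mean g"
  unfolding mean_def using supp finite_cube
  by (subst integral_measure_pmf_real [of "cube n"]) (auto simp: mult.commute)

lemma mean_const: "mean (\<lambda>_. c) = c"
  unfolding expectation_eq_mean [symmetric] by simp

lemma mean_mono: "(\<And>x. x \<in> cube n \<Longrightarrow> f x \<le> g x) \<Longrightarrow> mean f \<le> mean g"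
  unfolding mean_def by (intro sum_mono mult_left_mono) auto

lemma mean_cong: "(\<And>x. x \<in> cube n \<Longrightarrow> f x = g x) \<Longrightarrow> mean f = mean g"
  unfolding mean_def by (intro sum.cong) auto

lemma mean_add: "mean (\<lambda>x. f x + g x) = mean f + mean g"
  unfolding mean_def by (simp add: algebra_simps sum.distrib)

lemma mean_diff: "mean (\<lambda>x. f x - g x) = mean f - mean g"
  unfolding mean_def by (simp add: algebra_simps sum_subtractf)

lemma mean_cmult: "mean (\<lambda>x. c * f x) = c * mean f"
  unfolding mean_def by (simp add: algebra_simps sum_distrib_left)

lemma mean_nonneg: "(\<And>x. x \<in> cube n \<Longrightarrow> 0 \<le> f x) \<Longrightarrow> 0 \<le> mean f"
  unfolding mean_def by (intro sum_nonneg) auto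

lemma has_derivative_mean:
  assumes "\<And>x. x \<in> cube n \<Longrightarrow> ((\<lambda>r. f r x) has_real_derivative D x) (at t)"
  shows "((\<lambda>r. mean (f r)) has_real_derivative mean D) (at t)"
  unfolding mean_def using assms by (intro DERIV_sum DERIV_cmult) auto

text \<open>Invariance of \<open>\<mu>\<close>: \<open>\<mu> q\<^sub>i\<close> is invariant under the flip of coordinate \<open>i\<close>, so \<open>f\<close> and its flip
  have the same sum against it.\<close>

lemma mean_gen: "mean (gen n q f) = 0"
proof -
  have "(\<Sum>x\<in>cube n. pmf \<mu> x * (q i x * (f (flip x i) - f x))) = 0" if i: "i \<in> {1..n}" for i
  proof -
    have "(\<Sum>x\<in>cube n. pmf \<mu> x * q i x * f (flip x i)) = (\<Sum>x\<in>cube n. pmf \<mu> x * q i x * f x)"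
    proof (rule sum.reindex_bij_witness [of _ "\<lambda>x. flip x i" "\<lambda>x. flip x i"])
      fix x assume "x \<in> cube n"
      with i rev have "pmf \<mu> x * q i x = pmf \<mu> (flip x i) * q i (flip x i)"
        unfolding reversible_def by blast
      thus "pmf \<mu> (flip x i) * q i (flip x i) * f (flip x i) = pmf \<mu> x * q i x * f (flip x i)"
        by simp
    qed (use i in \<open>auto simp: flip_flip flip_in_cube\<close>)
    thus ?thesis by (simp add: algebra_simps sum_subtractf)
  qed
  hence "(\<Sum>i\<in>{1..n}. \<Sum>x\<in>cube n. pmf \<mu> x * (q i x * (f (flip x i) - f x))) = 0"
    by (intro sum.neutral) auto
  thus ?thesis unfolding mean_def gen_def sum_distrib_left
    by (subst sum.swap)
qed

lemma gen_nonpos_at_max: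
  assumes "x \<in> cube n" "\<And>y. y \<in> cube n \<Longrightarrow> h y \<le> h x"
  shows "gen n q h x \<le> 0"
  unfolding gen_def using assms flip_in_cube q_nonneg
  by (intro sum_nonpos mult_nonneg_nonpos) auto

text \<open>
  The proof works with solutions of \<open>u' = L u\<close> instead of the power series \<open>semigroup_at\<close>: positivity
  and conservation of the mean need only the equation, and affine images such as \<open>1 - u\<close> are
  obviously solutions again.
\<close>

definition heat_flow :: "(real \<Rightarrow> (nat \<Rightarrow> int) \<Rightarrow> real) \<Rightarrow> bool" where
  "heat_flow u \<longleftrightarrow>
     (\<forall>x\<in>cube n. \<forall>r. ((\<lambda>s. u s x) has_real_derivative gen n q (u r) x) (at r))"

lemma heat_flow_deriv:
  "heat_flow u \<Longrightarrow> x \<in> cube n \<Longrightarrow> ((\<lambda>s. u s x) has_real_derivative gen n q (u r) x) (at r)"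
  unfolding heat_flow_def by auto

lemma heat_flow_affine:
  assumes "heat_flow u" shows "heat_flow (\<lambda>r x. c * u r x + d)"
  unfolding heat_flow_def gen_affine
proof (intro ballI allI)
  fix x r assume "x \<in> cube n"
  from DERIV_add [OF DERIV_cmult [OF heat_flow_deriv [OF assms this], of c] DERIV_const [of d]]
  show "((\<lambda>s. c * u s x + d) has_real_derivative c * gen n q (u r) x) (at r)"
    by (simp only: add_0_right)
qed

text \<open>
  At a minimum point \<open>L u \<ge> 0\<close>, so a minimum cannot decrease. Subtracting \<open>d (1 + s)\<close> from \<open>- u\<close>
  makes both the initial condition and the derivative strictly negative, as \<open>first_crossing\<close> requires.
\<close>

lemma heat_flow_pos:
  assumes u: "heat_flow u" and init: "\<And>x. x \<in> cube n \<Longrightarrow> 0 \<le> u 0 x"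
    and r: "0 \<le> r" and x: "x \<in> cube n"
  shows "0 \<le> u r x"
proof (rule field_le_epsilon)
  fix e :: real assume e: "e > 0"
  define d where "d = e / (1 + r)"
  have d: "d > 0" using e r by (auto simp: d_def)
  have "- u r x - d * (1 + r) < 0"
  proof (rule first_crossing [OF finite_cube, where T = r and \<phi> = "\<lambda>s y. - u s y - d * (1 + s)"])
    show "continuous_on {0..r} (\<lambda>s. - u s y - d * (1 + s))" if "y \<in> cube n" for y
      using DERIV_continuous_on [of "{0..r}", OF has_field_derivative_at_within
          [OF heat_flow_deriv [OF u that]]]
      by (intro continuous_intros)
  next
    fix s y assume y: "y \<in> cube n" and mx: "- u s y - d * (1 + s) = 0"
      "\<forall>z\<in>cube n. - u s z - d * (1 + s) \<le> 0"
    have "gen n q (\<lambda>z. (-1) * u s z + 0) y \<le> 0"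
      using mx by (intro gen_nonpos_at_max [OF y]) force
    hence "- gen n q (u s) y - d < 0" using d unfolding gen_affine by simp
    moreover have "((\<lambda>s. - u s y - d * (1 + s)) has_real_derivative - gen n q (u s) y - d) (at s)"
      using heat_flow_deriv [OF u y, of s] by (auto intro!: derivative_eq_intros)
    ultimately show "\<exists>D<0. ((\<lambda>s. - u s y - d * (1 + s)) has_real_derivative D) (at s)" by blast
  next
    show "- u 0 y - d * (1 + 0) < 0" if "y \<in> cube n" for y
      using init [OF that] d by simp
  qed (use r x in auto)
  moreover have "d * (1 + r) = e" using r by (simp add: d_def)
  ultimately show "0 \<le> u r x + e" by linarith
qed

lemma mean_heat_flow:
  assumes "heat_flow u" shows "mean (u r) = mean (u 0)"
proof -
  have "((\<lambda>r. mean (u r)) has_real_derivative 0) (at t)" for t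
    using has_derivative_mean [of u "gen n q (u t)" t] heat_flow_deriv [OF assms] mean_gen by auto
  thus ?thesis using DERIV_isconst_all by blast
qed

section \<open>The semigroup as a heat flow\<close>

text \<open>
  On the finite cube \<open>L\<close> is a bounded operator, which gives the series of \<open>exp (t L)\<close> infinite radius
  of convergence.
\<close>

lemma gen_pow_bound:
  obtains M C where "0 \<le> M" "\<And>x k. x \<in> cube n \<Longrightarrow> \<bar>(gen n q ^^ k) f x\<bar> \<le> C * M ^ k"
proof -
  define C where "C = (\<Sum>x\<in>cube n. \<bar>f x\<bar>)"
  define M where "M = (\<Sum>i\<in>{1..n}. \<Sum>x\<in>cube n. 2 * q i x)"
  have C: "0 \<le> C" unfolding C_def by (intro sum_nonneg) auto
  have M: "0 \<le> M" unfolding M_def by (intro sum_nonneg) (auto simp: q_nonneg)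
  have "\<bar>(gen n q ^^ k) f x\<bar> \<le> C * M ^ k" if "x \<in> cube n" for k x
    using that
  proof (induction k arbitrary: x)
    case 0
    thus ?case unfolding C_def using member_le_sum [of x "cube n" "\<lambda>x. \<bar>f x\<bar>"] finite_cube by auto
  next
    case (Suc k)
    let ?h = "(gen n q ^^ k) f"
    have "\<bar>gen n q ?h x\<bar> \<le> (\<Sum>i\<in>{1..n}. \<bar>q i x * (?h (flip x i) - ?h x)\<bar>)"
      unfolding gen_def by (rule sum_abs)
    also have "\<dots> \<le> (\<Sum>i\<in>{1..n}. (\<Sum>y\<in>cube n. 2 * q i y) * (C * M ^ k))"
    proof (rule sum_mono)
      fix i assume i: "i \<in> {1..n}"
      have "\<bar>?h (flip x i) - ?h x\<bar> \<le> 2 * (C * M ^ k)"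
        using Suc.IH [OF Suc.prems] Suc.IH [OF flip_in_cube [OF i Suc.prems]] by linarith
      hence "\<bar>q i x * (?h (flip x i) - ?h x)\<bar> \<le> q i x * (2 * (C * M ^ k))"
        using q_nonneg [OF i Suc.prems] by (auto simp: abs_mult intro: mult_left_mono)
      also have "\<dots> = (2 * q i x) * (C * M ^ k)" by simp
      also have "\<dots> \<le> (\<Sum>y\<in>cube n. 2 * q i y) * (C * M ^ k)"
        using Suc.prems finite_cube q_nonneg [OF i] C M
        by (intro mult_right_mono member_le_sum) auto
      finally show "\<bar>q i x * (?h (flip x i) - ?h x)\<bar> \<le> (\<Sum>y\<in>cube n. 2 * q i y) * (C * M ^ k)" .
    qed
    also have "\<dots> = M * (C * M ^ k)"
      by (simp only: sum_distrib_right [symmetric] M_def [symmetric])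
    also have "\<dots> = C * M ^ Suc k" by simp
    finally show ?case by simp
  qed
  thus ?thesis using that M by blast
qed

lemma summable_semigroup:
  assumes "x \<in> cube n"
  shows "summable (\<lambda>k. (gen n q ^^ k) f x / fact k * t ^ k)"
proof -
  obtain M C where M: "0 \<le> M" and b: "\<And>x k. x \<in> cube n \<Longrightarrow> \<bar>(gen n q ^^ k) f x\<bar> \<le> C * M ^ k"
    using gen_pow_bound by blast
  show ?thesis
  proof (rule summable_comparison_test)
    show "\<exists>N. \<forall>k\<ge>N. norm ((gen n q ^^ k) f x / fact k * t ^ k) \<le> C * ((M * \<bar>t\<bar>) ^ k /\<^sub>R fact k)"
    proof (intro exI allI impI)
      fix k
      have "norm ((gen n q ^^ k) f x / fact k * t ^ k) = \<bar>(gen n q ^^ k) f x\<bar> * (\<bar>t\<bar> ^ k / fact k)"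
        by (simp add: abs_mult power_abs)
      also have "\<dots> \<le> C * M ^ k * (\<bar>t\<bar> ^ k / fact k)"
        using b [OF assms] by (intro mult_right_mono) auto
      finally show "norm ((gen n q ^^ k) f x / fact k * t ^ k) \<le> C * ((M * \<bar>t\<bar>) ^ k /\<^sub>R fact k)"
        by (simp add: power_mult_distrib field_simps)
    qed
    show "summable (\<lambda>k. C * ((M * \<bar>t\<bar>) ^ k /\<^sub>R fact k))"
      by (intro summable_mult summable_exp_generic)
  qed
qed

lemma heat_flow_semigroup: "heat_flow (\<lambda>t. semigroup_at n q t f)"
  unfolding heat_flow_def
proof (intro ballI allI)
  fix x r assume x: "x \<in> cube n"
  define c where "c = (\<lambda>y k. (gen n q ^^ k) f y / fact k)"
  have P: "semigroup_at n q t f y = (\<Sum>k. c y k * t ^ k)" for t y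
    unfolding semigroup_at_def c_def by (simp add: field_simps)
  have sm: "summable (\<lambda>k. c y k * t ^ k)" if "y \<in> cube n" for t y
    unfolding c_def by (rule summable_semigroup [OF that])
  have "((\<lambda>s. semigroup_at n q s f x) has_real_derivative (\<Sum>k. diffs (c x) k * r ^ k)) (at r)"
    unfolding P by (intro termdiffs_strong_converges_everywhere sm x)
  moreover have "(\<Sum>k. diffs (c x) k * r ^ k) = gen n q (semigroup_at n q r f) x"
  proof -
    have "diffs (c x) k * r ^ k = (\<Sum>i\<in>{1..n}. q i x * (c (flip x i) k * r ^ k - c x k * r ^ k))" for k
    proof -
      have cancel: "(a::real) * (b / (a * d)) = b / d" if "a \<noteq> 0" for a b d using that by simp
      have factor: "Q * (F - G) / d * R = Q * (F / d * R - G / d * R)" for Q F G d R :: real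
        by (simp add: diff_divide_distrib algebra_simps)
      have "diffs (c x) k = gen n q ((gen n q ^^ k) f) x / fact k"
        using cancel [of "real (Suc k)" "(gen n q ^^ Suc k) f x" "fact k"]
        unfolding diffs_def c_def fact_Suc by (simp only: funpow.simps o_def)
      hence "diffs (c x) k * r ^ k = gen n q ((gen n q ^^ k) f) x / fact k * r ^ k"
        by (rule arg_cong)
      also have "\<dots> = (\<Sum>i\<in>{1..n}. q i x * (c (flip x i) k * r ^ k - c x k * r ^ k))"
        by (simp only: gen_def sum_divide_distrib sum_distrib_right c_def factor)
      finally show ?thesis .
    qed
    hence "(\<Sum>k. diffs (c x) k * r ^ k)
         = (\<Sum>k. \<Sum>i\<in>{1..n}. q i x * (c (flip x i) k * r ^ k - c x k * r ^ k))" by simp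
    also have "\<dots> = (\<Sum>i\<in>{1..n}. \<Sum>k. q i x * (c (flip x i) k * r ^ k - c x k * r ^ k))"
      using x by (intro suminf_sum summable_mult summable_diff sm flip_in_cube)
    also have "\<dots> = (\<Sum>i\<in>{1..n}. q i x * ((\<Sum>k. c (flip x i) k * r ^ k) - (\<Sum>k. c x k * r ^ k)))"
      using x by (intro sum.cong refl)
        (simp add: suminf_mult suminf_diff sm flip_in_cube summable_diff)
    finally show ?thesis unfolding gen_def P .
  qed
  ultimately show "((\<lambda>s. semigroup_at n q s f x) has_real_derivative
      gen n q (semigroup_at n q r f) x) (at r)" by simp
qed

lemma semigroup_at_0: "semigroup_at n q 0 f = f"
proof
  fix x
  have "(\<Sum>k. 0 ^ k / fact k * (gen n q ^^ k) f x) = (\<Sum>k. (gen n q ^^ k) f x / fact k * 0 ^ k)"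
    by (simp add: field_simps)
  also have "\<dots> = f x" by (subst powser_zero) simp
  finally show "semigroup_at n q 0 f x = f x" unfolding semigroup_at_def .
qed

section \<open>Energy dissipation and the Bellman function\<close>

lemma Gamma_eq: "Gamma n q f x = 1/2 * (\<Sum>i\<in>{1..n}. q i x * (f (flip x i) - f x)\<^sup>2)"
  unfolding Gamma_def Gamma_w_def Gamma_bi_def by (simp add: power2_eq_square mult.assoc)

lemma Gamma_nonneg: "x \<in> cube n \<Longrightarrow> 0 \<le> Gamma n q f x"
  unfolding Gamma_eq using q_nonneg by (intro mult_nonneg_nonneg sum_nonneg) auto

text \<open>This makes \<open>\<Gamma>\<close> the carre du champ of \<open>L\<close>: it measures how far \<open>L\<close> is from a derivation.\<close>

lemma gen_square: "gen n q (\<lambda>y. (h y)\<^sup>2) x = 2 * h x * gen n q h x + 2 * Gamma n q h x"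
proof -
  have "q i x * ((h (flip x i))\<^sup>2 - (h x)\<^sup>2)
      = 2 * h x * (q i x * (h (flip x i) - h x)) + q i x * (h (flip x i) - h x)\<^sup>2" for i
    by (simp add: power2_eq_square algebra_simps)
  thus ?thesis unfolding gen_def Gamma_eq
    by (simp add: sum.distrib sum_distrib_left)
qed

lemma has_derivative_energy:
  assumes "heat_flow u"
  shows "((\<lambda>r. mean (\<lambda>x. (u r x)\<^sup>2)) has_real_derivative - 2 * mean (Gamma n q (u t))) (at t)"
proof -
  have "((\<lambda>r. mean (\<lambda>x. (u r x)\<^sup>2)) has_real_derivative
      mean (\<lambda>x. 2 * (u t x * gen n q (u t) x))) (at t)"
    by (rule has_derivative_mean)
      (use heat_flow_deriv [OF assms, of _ t] in \<open>auto intro!: derivative_eq_intros\<close>)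
  moreover
  have "mean (\<lambda>x. 2 * u t x * gen n q (u t) x + 2 * Gamma n q (u t) x) = 0"
    using mean_gen [of "\<lambda>y. (u t y)\<^sup>2"] unfolding gen_square .
  hence "mean (\<lambda>x. 2 * (u t x * gen n q (u t) x)) = - 2 * mean (Gamma n q (u t))"
    unfolding mean_add mult.assoc mean_cmult by linarith
  ultimately show ?thesis by simp
qed

text \<open>
  The heart of the upper bound. It is linear in \<open>E[v]\<close> although the gradient hypothesis is quadratic in
  \<open>v\<close>. The function \<open>G(r) = E[B(u\<^sub>r, v\<^sub>r) + u\<^sub>r\<^sup>2]\<close> replaces the energy: its second term loses
  \<open>2 E[\<Gamma>(u)]\<close>, while concavity of \<open>B\<close> wins back \<open>2 E[p\<^sup>2 \<Gamma>(u)]\<close> with \<open>p = v / (u (1 - u) + v)\<close>.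
  The net loss \<open>2 E[(1 - p\<^sup>2) \<Gamma>(u)]\<close> is at most \<open>2 C E[(1 - p\<^sup>2) v\<^sup>2]\<close>, and
  \<open>(1 - p\<^sup>2) v\<^sup>2 \<le> v / 2\<close> because \<open>1 - p \<le> 1 / (4 v)\<close>. At time zero \<open>B\<close> vanishes since \<open>u\<close> is Boolean;
  at time \<open>t\<close> it is at most \<open>v\<close>.
\<close>

lemma energy_drop_le:
  assumes u: "heat_flow u" and v: "heat_flow v" and t: "0 \<le> t" and C: "0 \<le> C"
    and u01: "\<And>r x. 0 \<le> r \<Longrightarrow> r \<le> t \<Longrightarrow> x \<in> cube n \<Longrightarrow> 0 \<le> u r x \<and> u r x \<le> 1"
    and vpos: "\<And>r x. 0 \<le> r \<Longrightarrow> r \<le> t \<Longrightarrow> x \<in> cube n \<Longrightarrow> 0 < v r x"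
    and bool: "\<And>x. x \<in> cube n \<Longrightarrow> u 0 x \<in> {0, 1}"
    and grad: "\<And>r x. 0 \<le> r \<Longrightarrow> r \<le> t \<Longrightarrow> x \<in> cube n \<Longrightarrow> Gamma n q (u r) x \<le> C * (v r x)\<^sup>2"
  shows "mean (\<lambda>x. (u 0 x)\<^sup>2) - mean (\<lambda>x. (u t x)\<^sup>2) \<le> (1 + C * t) * mean (v 0)"
proof -
  define B :: "real \<Rightarrow> real \<Rightarrow> real" where "B = (\<lambda>m k. (m * (1 - m)) * k / (m * (1 - m) + k))"
  define p where "p = (\<lambda>r x. v r x / (u r x * (1 - u r x) + v r x))"
  define G where "G = (\<lambda>r. mean (\<lambda>x. B (u r x) (v r x) + (u r x)\<^sup>2))"
  define D where "D = (\<lambda>r x. (p r x)\<^sup>2 * (1 - 2 * u r x) * gen n q (u r) x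
      + (1 - p r x)\<^sup>2 * gen n q (v r) x + 2 * u r x * gen n q (u r) x)"
  (* Concavity of the harmonic mean in usable form: it is the minimum over s of these linear
     functions of (x, y), attained at s = y / (x + y). *)
  have upper: "x * y / (x + y) \<le> s\<^sup>2 * x + (1 - s)\<^sup>2 * y" if "0 \<le> x" "0 < y" for x y s :: real
  proof -
    have "(s\<^sup>2 * x + (1 - s)\<^sup>2 * y) * (x + y) - x * y = (s * x - (1 - s) * y)\<^sup>2"
      by (simp add: power2_eq_square algebra_simps)
    also have "\<dots> \<ge> 0" by simp
    finally have "x * y \<le> (s\<^sup>2 * x + (1 - s)\<^sup>2 * y) * (x + y)" by linarith
    thus ?thesis using that by (simp add: divide_le_eq)
  qed
  have G_deriv: "(G has_real_derivative mean (D r)) (at r)" if r: "0 \<le> r" "r \<le> t" for r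
    unfolding G_def
  proof (rule has_derivative_mean)
    fix x assume x: "x \<in> cube n"
    note du = heat_flow_deriv [OF u x, of r] and dv = heat_flow_deriv [OF v x, of r]
    let ?X = "u r x * (1 - u r x)" and ?L = "gen n q (u r) x" and ?K = "gen n q (v r) x"
    have pos: "?X + v r x > 0" using u01 [OF r x] vpos [OF r x] by (simp add: add_nonneg_pos)
    have dX: "((\<lambda>s. u s x * (1 - u s x)) has_real_derivative (1 - 2 * u r x) * ?L) (at r)"
      using du by (auto intro!: derivative_eq_intros simp: algebra_simps)
    have dB: "((\<lambda>s. B (u s x) (v s x)) has_real_derivative
        (((1 - 2 * u r x) * ?L * v r x + ?K * ?X) * (?X + v r x)
         - ?X * v r x * ((1 - 2 * u r x) * ?L + ?K)) / ((?X + v r x) * (?X + v r x))) (at r)"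
      unfolding B_def
      using DERIV_divide [OF DERIV_mult [OF dX dv] DERIV_add [OF dX dv]] pos by simp
    (* The derivative of the harmonic mean is that of the linear function supporting it. *)
    have q1: "1 - p r x = ?X / (?X + v r x)"
      using pos unfolding p_def by (simp add: field_simps)
    have "((a * y + k * x') * (x' + y) - x' * y * (a + k)) / ((x' + y) * (x' + y))
        = (y / (x' + y))\<^sup>2 * a + (x' / (x' + y))\<^sup>2 * k" if "x' + y > 0" for a k x' y :: real
      using that by (simp add: power_divide power2_eq_square add_divide_distrib [symmetric]) (simp add: algebra_simps)
    from this [OF pos, of "(1 - 2 * u r x) * ?L" ?K]
    have eq: "(((1 - 2 * u r x) * ?L * v r x + ?K * ?X) * (?X + v r x)
         - ?X * v r x * ((1 - 2 * u r x) * ?L + ?K)) / ((?X + v r x) * (?X + v r x))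
       = (p r x)\<^sup>2 * (1 - 2 * u r x) * ?L + (1 - p r x)\<^sup>2 * ?K"
      unfolding q1 unfolding p_def by (simp only: mult.assoc)
    have dsq: "((\<lambda>s. (u s x)\<^sup>2) has_real_derivative 2 * u r x * ?L) (at r)"
      using du by (auto intro!: derivative_eq_intros)
    show "((\<lambda>s. B (u s x) (v s x) + (u s x)\<^sup>2) has_real_derivative D r x) (at r)"
      using DERIV_add [OF dB [unfolded eq] dsq] unfolding D_def .
  qed
  have D_lower: "- C * mean (v 0) \<le> mean (D r)" if r: "0 \<le> r" "r \<le> t" for r
  proof -
    let ?LB = "gen n q (\<lambda>y. B (u r y) (v r y))" and ?LS = "gen n q (\<lambda>y. (u r y)\<^sup>2)"
    have pt: "- C * v r x + ?LB x + ?LS x \<le> D r x" if x: "x \<in> cube n" for x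
    proof -
      let ?X = "\<lambda>y. u r y * (1 - u r y)" and ?p = "p r x"
      have X: "0 \<le> ?X y" if "y \<in> cube n" for y using u01 [OF r that] by simp
      have pos: "?X x + v r x > 0" using X [OF x] vpos [OF r x] by (simp add: add_nonneg_pos)
      have Bx: "B (u r x) (v r x) = ?p\<^sup>2 * ?X x + (1 - ?p)\<^sup>2 * v r x"
      proof -
        have "a * k / (a + k) = (k / (a + k))\<^sup>2 * a + (a / (a + k))\<^sup>2 * k" if "a + k > 0" for a k :: real
          using that by (simp add: power_divide power2_eq_square add_divide_distrib [symmetric]
              divide_simps) (simp add: algebra_simps)
        moreover have "1 - ?p = ?X x / (?X x + v r x)"
          using pos unfolding p_def by (simp add: field_simps)
        ultimately show ?thesis unfolding B_def p_def using pos by metis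
      qed
      (* At every neighbour B lies below the linear function in (m (1 - m), k) that touches it at x.
         Since m (1 - m) is itself quadratic, each jump of u contributes an extra square. *)
      have "?LB x \<le> (\<Sum>i\<in>{1..n}. ?p\<^sup>2 * (1 - 2 * u r x) * (q i x * (u r (flip x i) - u r x))
            + (1 - ?p)\<^sup>2 * (q i x * (v r (flip x i) - v r x))
            - ?p\<^sup>2 * (q i x * (u r (flip x i) - u r x)\<^sup>2))"
        unfolding gen_def
      proof (rule sum_mono)
        fix i assume i: "i \<in> {1..n}"
        let ?y = "flip x i"
        have y: "?y \<in> cube n" using flip_in_cube [OF i x] .
        have "B (u r ?y) (v r ?y) \<le> ?p\<^sup>2 * ?X ?y + (1 - ?p)\<^sup>2 * v r ?y"
          unfolding B_def by (rule upper [OF X [OF y] vpos [OF r y]])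
        hence "B (u r ?y) (v r ?y) - B (u r x) (v r x)
            \<le> ?p\<^sup>2 * (?X ?y - ?X x) + (1 - ?p)\<^sup>2 * (v r ?y - v r x)"
          unfolding Bx by (simp add: algebra_simps)
        also have "?X ?y - ?X x = (1 - 2 * u r x) * (u r ?y - u r x) - (u r ?y - u r x)\<^sup>2"
          by (simp add: power2_eq_square algebra_simps)
        finally have "q i x * (B (u r ?y) (v r ?y) - B (u r x) (v r x))
           \<le> q i x * (?p\<^sup>2 * ((1 - 2 * u r x) * (u r ?y - u r x) - (u r ?y - u r x)\<^sup>2)
              + (1 - ?p)\<^sup>2 * (v r ?y - v r x))"
          using q_nonneg [OF i x] by (rule mult_left_mono)
        thus "q i x * (B (u r ?y) (v r ?y) - B (u r x) (v r x))
          \<le> ?p\<^sup>2 * (1 - 2 * u r x) * (q i x * (u r ?y - u r x))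
            + (1 - ?p)\<^sup>2 * (q i x * (v r ?y - v r x)) - ?p\<^sup>2 * (q i x * (u r ?y - u r x)\<^sup>2)"
          by (simp add: algebra_simps)
      qed
      also have "\<dots> = ?p\<^sup>2 * (1 - 2 * u r x) * gen n q (u r) x + (1 - ?p)\<^sup>2 * gen n q (v r) x
            - 2 * ?p\<^sup>2 * Gamma n q (u r) x"
        unfolding gen_def Gamma_eq by (simp add: sum_subtractf sum.distrib sum_distrib_left)
      finally have LB: "?LB x + ?LS x \<le> D r x + 2 * (1 - ?p\<^sup>2) * Gamma n q (u r) x"
        unfolding gen_square D_def by (simp add: algebra_simps)
      have p01: "0 \<le> ?p" "?p \<le> 1"
        using pos X [OF x] vpos [OF r x] unfolding p_def by (auto simp: divide_le_eq)
      have "(1 - ?p\<^sup>2) * (v r x)\<^sup>2 \<le> v r x / 2"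
      proof -
        have "1 - ?p\<^sup>2 = (1 - ?p) * (1 + ?p)" by (simp add: power2_eq_square algebra_simps)
        also have "\<dots> \<le> (1 - ?p) * 2" using p01 by (intro mult_left_mono) auto
        finally have "(1 - ?p\<^sup>2) * (v r x)\<^sup>2 \<le> (1 - ?p) * 2 * (v r x)\<^sup>2"
          by (rule mult_right_mono) simp
        also have "\<dots> = 2 * ((1 - ?p) * v r x) * v r x" by (simp add: power2_eq_square)
        also have "\<dots> \<le> 2 * (1 / 4) * v r x"
        proof (intro mult_right_mono mult_left_mono)
          have "1 - ?p = ?X x / (?X x + v r x)" using pos unfolding p_def by (simp add: field_simps)
          hence "(1 - ?p) * v r x = ?X x * (v r x / (?X x + v r x))" by simp
          also have "\<dots> \<le> ?X x * 1"
            using X [OF x] vpos [OF r x] pos by (intro mult_left_mono) (auto simp: divide_le_eq)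
          also have "\<dots> \<le> 1 / 4"
            using zero_le_power2 [of "u r x - 1/2"] by (simp add: power2_eq_square algebra_simps)
          finally show "(1 - ?p) * v r x \<le> 1 / 4" .
        qed (use vpos [OF r x] in auto)
        finally show ?thesis by simp
      qed
      hence "C * ((1 - ?p\<^sup>2) * (v r x)\<^sup>2) \<le> C * (v r x / 2)" using C by (rule mult_left_mono)
      moreover have "(1 - ?p\<^sup>2) * Gamma n q (u r) x \<le> (1 - ?p\<^sup>2) * (C * (v r x)\<^sup>2)"
        using grad [OF r x] p01 by (intro mult_left_mono) (auto simp: power_le_one)
      ultimately have "2 * (1 - ?p\<^sup>2) * Gamma n q (u r) x \<le> C * v r x"
        by (simp add: algebra_simps)
      thus ?thesis using LB by linarith
    qed
    (* The two generator terms have mean zero, so only the term in v survives. *)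
    have "mean (\<lambda>x. - C * v r x + ?LB x + ?LS x) \<le> mean (D r)" by (rule mean_mono) (rule pt)
    thus ?thesis by (simp only: mean_add mean_cmult mean_gen mean_heat_flow [OF v, of r])
  qed
  have "G 0 + C * mean (v 0) * 0 \<le> G t + C * mean (v 0) * t"
  proof (rule DERIV_nonneg_imp_nondecreasing [OF t])
    fix r assume "0 \<le> r" "r \<le> t"
    note r = this
    have "((\<lambda>r. G r + C * mean (v 0) * r) has_real_derivative mean (D r) + C * mean (v 0)) (at r)"
      using G_deriv [OF r] by (auto intro!: derivative_eq_intros)
    thus "\<exists>y. ((\<lambda>r. G r + C * mean (v 0) * r) has_real_derivative y) (at r) \<and> 0 \<le> y"
      using D_lower [OF r] by (intro exI conjI) auto
  qed
  moreover have "G 0 = mean (\<lambda>x. (u 0 x)\<^sup>2)"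
    unfolding G_def using bool by (intro mean_cong) (force simp: B_def)
  moreover have "G t \<le> mean (v 0) + mean (\<lambda>x. (u t x)\<^sup>2)"
  proof -
    have "G t \<le> mean (\<lambda>x. v t x + (u t x)\<^sup>2)" unfolding G_def
    proof (rule mean_mono)
      fix x assume x: "x \<in> cube n"
      have "B (u t x) (v t x) \<le> v t x"
        unfolding B_def using upper [of "u t x * (1 - u t x)" "v t x" 0] u01 [OF t _ x] vpos [OF t _ x]
        by simp
      thus "B (u t x) (v t x) + (u t x)\<^sup>2 \<le> v t x + (u t x)\<^sup>2" by simp
    qed
    thus ?thesis by (simp add: mean_add mean_heat_flow [OF v, of t])
  qed
  ultimately show ?thesis by (simp add: algebra_simps)
qed

section \<open>Energy decay from the log-Sobolev inequality\<close>

text \<open>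
  Jensen's inequality for \<open>log (1 / h)\<close> under the probability density \<open>h\<^sup>2 / E[h\<^sup>2]\<close>. In the proof it
  appears as the tangent of the logarithm at \<open>E[h] / E[h\<^sup>2]\<close>, the mean of \<open>1 / h\<close> under that density;
  multiplied by \<open>h\<^sup>2\<close> the tangent inequality also holds where \<open>h = 0\<close>.
\<close>

lemma Ent_square_ge:
  assumes h: "\<And>x. x \<in> cube n \<Longrightarrow> 0 \<le> h x" and a: "0 < mean h" and y: "0 < mean (\<lambda>x. (h x)\<^sup>2)"
  shows "mean (\<lambda>x. (h x)\<^sup>2) * ln (mean (\<lambda>x. (h x)\<^sup>2) / (mean h)\<^sup>2) \<le> Ent \<mu> (\<lambda>x. (h x)\<^sup>2)"
proof -
  define a y where "a = mean h" and "y = mean (\<lambda>x. (h x)\<^sup>2)"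
  note pos = a [folded a_def] y [folded y_def]
  have "mean (\<lambda>x. (2 * ln (y / a) + 2) * (h x)\<^sup>2 + (- 2 * y / a) * h x)
      \<le> mean (\<lambda>x. (h x)\<^sup>2 * ln ((h x)\<^sup>2))"
  proof (rule mean_mono)
    fix x assume x: "x \<in> cube n"
    show "(2 * ln (y / a) + 2) * (h x)\<^sup>2 + (- 2 * y / a) * h x \<le> (h x)\<^sup>2 * ln ((h x)\<^sup>2)"
    proof (cases "h x = 0")
      case False
      hence hx: "h x > 0" using h [OF x] by simp
      have "ln (y / (a * h x)) \<le> y / (a * h x) - 1"
        using pos hx by (intro ln_le_minus_one) auto
      hence "ln (y / a) + 1 - y / (a * h x) \<le> ln (h x)"
        using pos hx by (simp add: ln_div ln_mult)
      hence "2 * (h x)\<^sup>2 * (ln (y / a) + 1 - y / (a * h x)) \<le> 2 * (h x)\<^sup>2 * ln (h x)"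
        by (intro mult_left_mono) auto
      moreover have "2 * (h x)\<^sup>2 * (ln (y / a) + 1 - y / (a * h x))
          = (2 * ln (y / a) + 2) * (h x)\<^sup>2 + (- 2 * y / a) * h x"
        using pos hx by (simp add: field_simps power2_eq_square)
      moreover have "ln ((h x)\<^sup>2) = 2 * ln (h x)" using hx by (simp add: ln_realpow)
      ultimately show ?thesis by simp
    qed simp
  qed
  moreover have "mean (\<lambda>x. (2 * ln (y / a) + 2) * (h x)\<^sup>2 + (- 2 * y / a) * h x) = 2 * y * ln (y / a)"
    unfolding mean_add mean_cmult using pos by (simp add: a_def [symmetric] y_def [symmetric] algebra_simps)
  moreover have "y * ln (y / a\<^sup>2) = 2 * y * ln (y / a) - y * ln y"
    using pos by (simp add: ln_div ln_realpow algebra_simps)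
  ultimately show ?thesis
    unfolding Ent_def expectation_eq_mean a_def [symmetric] y_def [symmetric] by simp
qed

text \<open>
  For \<open>y(r) = E[u\<^sub>r\<^sup>2]\<close> the preceding lemma turns the log-Sobolev inequality into
  \<open>y' \<le> - \<rho> y log (y / a\<^sup>2)\<close>, so \<open>exp (\<rho> r) log (y / a\<^sup>2)\<close> decreases. This plays the role of
  hypercontractivity and avoids interpolating between \<open>L\<^sup>p\<close> norms.
\<close>

lemma energy_decay:
  assumes lsi: "log_Sobolev n \<mu> q \<rho>" and \<rho>: "0 < \<rho>" and u: "heat_flow u" and t: "0 \<le> t"
    and unn: "\<And>r x. 0 \<le> r \<Longrightarrow> x \<in> cube n \<Longrightarrow> 0 \<le> u r x"
    and bool: "\<And>x. x \<in> cube n \<Longrightarrow> u 0 x \<in> {0, 1}"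
    and a: "a = mean (u 0)" "0 < a"
  shows "mean (\<lambda>x. (u t x)\<^sup>2) \<le> a * exp (- (1 - exp (- \<rho> * t)) * ln (1 / a))"
proof -
  define y where "y = (\<lambda>r. mean (\<lambda>x. (u r x)\<^sup>2))"
  have mu: "mean (u r) = a" for r using mean_heat_flow [OF u] a by simp
  (* The energy never falls below the square of the mean, so its logarithm is defined. *)
  have ypos: "0 < y r" for r
  proof -
    have "0 \<le> mean (\<lambda>x. (u r x - a)\<^sup>2)" by (rule mean_nonneg) simp
    also have "\<dots> = mean (\<lambda>x. (u r x)\<^sup>2 + ((- 2 * a) * u r x + a\<^sup>2))"
      by (rule mean_cong) (simp add: power2_eq_square algebra_simps)
    also have "\<dots> = y r - a\<^sup>2"
      unfolding mean_add mean_cmult mean_const mu y_def by (simp add: power2_eq_square)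
    finally show ?thesis using a(2) by (smt (verit) zero_less_power)
  qed
  have dy: "(y has_real_derivative - 2 * mean (Gamma n q (u r))) (at r)" for r
    unfolding y_def by (rule has_derivative_energy [OF u])
  have "exp (\<rho> * t) * ln (y t / a\<^sup>2) \<le> exp (\<rho> * 0) * ln (y 0 / a\<^sup>2)"
  proof (rule DERIV_nonpos_imp_nonincreasing [OF t])
    fix r assume r: "0 \<le> r" "r \<le> t"
    have "y r * ln (y r / a\<^sup>2) \<le> Ent \<mu> (\<lambda>x. (u r x)\<^sup>2)"
      using Ent_square_ge [of "u r"] unn [OF r(1)] mu [of r] a ypos [of r] unfolding y_def by simp
    also have "\<dots> \<le> 2 / \<rho> * mean (Gamma n q (u r))"
      using lsi unfolding log_Sobolev_def expectation_eq_mean by blast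
    finally have le: "y r * ln (y r / a\<^sup>2) \<le> 2 / \<rho> * mean (Gamma n q (u r))" .
    have "\<rho> * l + (- 2 * g) / z \<le> 0" if "z * l \<le> 2 / \<rho> * g" "z > 0" for l g z :: real
    proof -
      have "\<rho> * (z * l) \<le> \<rho> * (2 / \<rho> * g)" using that(1) \<rho> by (intro mult_left_mono) auto
      thus ?thesis using that(2) \<rho> by (simp add: divide_simps) (simp add: algebra_simps)
    qed
    from this [OF le ypos]
    have "\<rho> * ln (y r / a\<^sup>2) + (- 2 * mean (Gamma n q (u r))) / y r \<le> 0" .
    hence "exp (\<rho> * r) * (\<rho> * ln (y r / a\<^sup>2) + (- 2 * mean (Gamma n q (u r))) / y r) \<le> 0"
      by (simp add: mult_nonneg_nonpos)
    moreover have "((\<lambda>r. exp (\<rho> * r) * ln (y r / a\<^sup>2)) has_real_derivative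
        exp (\<rho> * r) * (\<rho> * ln (y r / a\<^sup>2) + (- 2 * mean (Gamma n q (u r))) / y r)) (at r)"
    proof -
      have d1: "((\<lambda>r. exp (\<rho> * r)) has_real_derivative exp (\<rho> * r) * \<rho>) (at r)"
        by (auto intro!: derivative_eq_intros)
      have d2: "((\<lambda>r. ln (y r / a\<^sup>2)) has_real_derivative
          1 / (y r / a\<^sup>2) * (- 2 * mean (Gamma n q (u r)) / a\<^sup>2)) (at r)"
        using ypos [of r] a(2) by (intro DERIV_chain2 [OF DERIV_ln_divide] DERIV_cdivide dy) auto
      have "1 / (y r / a\<^sup>2) * (- 2 * mean (Gamma n q (u r)) / a\<^sup>2)
          = - 2 * mean (Gamma n q (u r)) / y r"
        using a(2) by simp
      from DERIV_mult [OF d1 d2 [unfolded this]] show ?thesis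
        by (rule DERIV_cong) (simp add: algebra_simps)
    qed
    ultimately show "\<exists>d. ((\<lambda>r. exp (\<rho> * r) * ln (y r / a\<^sup>2)) has_real_derivative d) (at r) \<and> d \<le> 0"
      by blast
  qed
  moreover have "y 0 = a" unfolding y_def a(1) using bool by (intro mean_cong) fastforce
  ultimately have "exp (\<rho> * t) * (ln (y t) - 2 * ln a) \<le> - ln a"
    using a(2) ypos [of t] by (simp add: ln_div ln_realpow)
  hence "exp (- \<rho> * t) * (exp (\<rho> * t) * (ln (y t) - 2 * ln a)) \<le> exp (- \<rho> * t) * (- ln a)"
    by (rule mult_left_mono) simp
  hence "ln (y t) \<le> ln a + (- (1 - exp (- \<rho> * t)) * ln (1 / a))"
    using a(2) by (simp only: mult.assoc [symmetric] exp_add [symmetric])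
      (simp add: ln_div algebra_simps)
  hence "exp (ln (y t)) \<le> exp (ln a + (- (1 - exp (- \<rho> * t)) * ln (1 / a)))" by simp
  thus ?thesis using ypos [of t] a(2) unfolding y_def exp_add by simp
qed

text \<open>
  For \<open>a \<le> 1/2\<close> the quantities \<open>m = log (1 / a)\<close> and \<open>l = log (e / (a (1 - a)))\<close> are comparable,
  \<open>m \<le> l \<le> 4 m\<close>. The condition \<open>\<rho> t l \<le> 1\<close> keeps the arguments of both exponentials in the range
  where \<open>1 - exp (- s) \<ge> s / 2\<close>; the constant 16 collects the factor 4 and two factors 2.
\<close>

lemma energy_drop_ge_small:
  assumes lsi: "log_Sobolev n \<mu> q \<rho>" and \<rho>: "0 < \<rho>" and u: "heat_flow u" and t: "0 \<le> t"
    and unn: "\<And>r x. 0 \<le> r \<Longrightarrow> x \<in> cube n \<Longrightarrow> 0 \<le> u r x"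
    and bool: "\<And>x. x \<in> cube n \<Longrightarrow> u 0 x \<in> {0, 1}"
    and a: "a = mean (u 0)" "0 < a" "a \<le> 1 / 2"
    and l: "l = ln (exp 1 / (a * (1 - a)))" and tl: "\<rho> * t * l \<le> 1"
  shows "a * (1 - a) * (\<rho> * t * l / 16) \<le> mean (\<lambda>x. (u 0 x)\<^sup>2) - mean (\<lambda>x. (u t x)\<^sup>2)"
proof -
  have quad: "s / 2 \<le> 1 - exp (- s)" if s: "0 \<le> s" "s \<le> 1" for s :: real
  proof -
    have "0 \<le> s * (1 - s) / 2" using s by simp
    hence "1 \<le> (1 - s / 2) * (1 + s)" by (simp add: algebra_simps)
    also have "\<dots> \<le> (1 - s / 2) * exp s"
      using s exp_ge_add_one_self [of s] by (intro mult_left_mono) auto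
    finally have "exp (- s) * 1 \<le> exp (- s) * ((1 - s / 2) * exp s)"
      by (rule mult_left_mono) simp
    also have "\<dots> = 1 - s / 2" by (simp add: exp_minus)
    finally show ?thesis by simp
  qed
  define m where "m = ln (1 / a)"
  define s where "s = \<rho> * t"
  have s0: "0 \<le> s" using \<rho> t by (simp add: s_def)
  have l_eq: "l = 1 + m - ln (1 - a)"
    unfolding l m_def using a by (simp add: ln_div ln_mult)
  have ln2: "1 / 2 \<le> ln (2 :: real)"
    using ln_le_minus_one [of "1 / 2 :: real"] by (simp add: ln_div)
  have m_ge: "ln 2 \<le> m"
    unfolding m_def using a by (subst ln_le_cancel_iff) (auto simp: field_simps)
  have "- ln (1 - a) \<le> ln 2"
  proof -
    have "ln (1 / 2) \<le> ln (1 - a)" using a by (subst ln_le_cancel_iff) auto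
    thus ?thesis by (simp add: ln_div)
  qed
  hence lm: "l \<le> 4 * m" using ln2 m_ge unfolding l_eq by linarith
  have l1: "1 \<le> l"
  proof -
    have "ln (1 - a) \<le> 0" using a by simp
    thus ?thesis using ln2 m_ge unfolding l_eq by linarith
  qed
  have ml: "m \<le> l"
  proof -
    have "ln (1 - a) \<le> 0" using a by simp
    thus ?thesis unfolding l_eq by linarith
  qed
  have m0: "0 \<le> m" using ln2 m_ge by linarith
  have "s * 1 \<le> s * l" using s0 l1 by (rule mult_left_mono [rotated])
  hence s1: "s \<le> 1" using tl by (simp add: s_def)
  have "s * m \<le> s * l" using s0 ml by (rule mult_left_mono [rotated])
  hence sm1: "s * m \<le> 1" using tl by (simp add: s_def)
  have "mean (\<lambda>x. (u t x)\<^sup>2) \<le> a * exp (- (1 - exp (- \<rho> * t)) * ln (1 / a))"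
    by (rule energy_decay [OF lsi \<rho> u t _ _ a(1,2)]) (fact unn, fact bool)
  hence "mean (\<lambda>x. (u t x)\<^sup>2) \<le> a * exp (- (1 - exp (- s)) * m)"
    by (simp only: m_def s_def mult_minus_left)
  also have "\<dots> \<le> a * exp (- (s / 2 * m))"
  proof (intro mult_left_mono)
    have "- (1 - exp (- s)) * m \<le> - (s / 2 * m)"
      using mult_right_mono [OF quad [OF s0 s1] m0] by (simp only: mult_minus_left neg_le_iff_le)
    thus "exp (- (1 - exp (- s)) * m) \<le> exp (- (s / 2 * m))" by simp
  qed (use a(2) in simp)
  also have "\<dots> \<le> a * (1 - s * m / 4)"
    using quad [of "s / 2 * m"] s0 m0 sm1 a(2) by (intro mult_left_mono) auto
  finally have 1: "a * (s * m / 4) \<le> a - mean (\<lambda>x. (u t x)\<^sup>2)" by (simp add: algebra_simps)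
  have 2: "mean (\<lambda>x. (u 0 x)\<^sup>2) = a" unfolding a(1) using bool by (intro mean_cong) fastforce
  have "a * (1 - a) * (s * l / 16) \<le> a * (s * l / 16)"
    using a s0 l1 by (intro mult_right_mono) (auto simp: algebra_simps)
  also have "\<dots> \<le> a * (s * m / 4)"
  proof (intro mult_left_mono)
    have "s * l \<le> 4 * (s * m)" using mult_left_mono [OF lm s0] by (simp only: mult.left_commute)
    thus "s * l / 16 \<le> s * m / 4" by linarith
  qed (use a(2) in simp)
  finally show ?thesis using 1 unfolding 2 s_def by (rule order_trans)
qed

text \<open>Replacing \<open>f\<close> by \<open>1 - f\<close> changes neither the energy drop nor the variance, so \<open>a \<le> 1/2\<close> is no loss.\<close>

lemma energy_drop_ge:
  assumes lsi: "log_Sobolev n \<mu> q \<rho>" and \<rho>: "0 < \<rho>" and u: "heat_flow u" and t: "0 \<le> t"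
    and u01: "\<And>r x. 0 \<le> r \<Longrightarrow> x \<in> cube n \<Longrightarrow> 0 \<le> u r x \<and> u r x \<le> 1"
    and bool: "\<And>x. x \<in> cube n \<Longrightarrow> u 0 x \<in> {0, 1}"
    and a: "a = mean (u 0)" "0 < a" "a < 1"
    and l: "l = ln (exp 1 / (a * (1 - a)))" and tl: "\<rho> * t * l \<le> 1"
  shows "a * (1 - a) * (\<rho> * t * l / 16) \<le> mean (\<lambda>x. (u 0 x)\<^sup>2) - mean (\<lambda>x. (u t x)\<^sup>2)"
proof (cases "a \<le> 1 / 2")
  case True
  show ?thesis
    by (rule energy_drop_ge_small [OF lsi \<rho> u t _ bool a(1,2) True l tl]) (use u01 in auto)
next
  case False
  define v where "v = (\<lambda>r x. (- 1) * u r x + 1)"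
  have v: "heat_flow v" unfolding v_def by (rule heat_flow_affine [OF u])
  have av: "1 - a = mean (v 0)" unfolding v_def mean_add mean_cmult mean_const a(1) by simp
  have "(1 - a) * (1 - (1 - a)) * (\<rho> * t * l / 16)
      \<le> mean (\<lambda>x. (v 0 x)\<^sup>2) - mean (\<lambda>x. (v t x)\<^sup>2)"
  proof (rule energy_drop_ge_small [OF lsi \<rho> v t _ _ av])
    show "0 \<le> v r x" if "0 \<le> r" "x \<in> cube n" for r x using u01 [OF that] by (simp add: v_def)
    show "v 0 x \<in> {0, 1}" if "x \<in> cube n" for x using bool [OF that] by (auto simp: v_def)
    show "l = ln (exp 1 / ((1 - a) * (1 - (1 - a))))" unfolding l by (simp add: mult.commute)
  qed (use a False tl in auto)
  moreover have "mean (\<lambda>x. (v r x)\<^sup>2) = mean (\<lambda>x. (u r x)\<^sup>2) + (1 - 2 * a)" for r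
  proof -
    have "mean (\<lambda>x. (v r x)\<^sup>2) = mean (\<lambda>x. (u r x)\<^sup>2 + ((- 2) * u r x + 1))"
      unfolding v_def by (rule mean_cong) (simp add: power2_eq_square algebra_simps)
    thus ?thesis
      unfolding mean_add mean_cmult mean_const mean_heat_flow [OF u, of r] a(1) by simp
  qed
  ultimately show ?thesis by (simp add: mult.commute mult.left_commute)
qed

section \<open>The gradient estimate\<close>

lemma Gamma_w_eq: "Gamma_w n q w f x = 1/2 * (\<Sum>i\<in>{1..n}. w i x * q i x * (f (flip x i) - f x)\<^sup>2)"
  unfolding Gamma_w_def Gamma_bi_def by (simp add: power2_eq_square mult.assoc)

lemma Gamma_w_nonneg:
  assumes "\<And>i. i \<in> {1..n} \<Longrightarrow> 0 \<le> w i x" "x \<in> cube n"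
  shows "0 \<le> Gamma_w n q w f x"
  unfolding Gamma_w_eq using assms q_nonneg by (intro mult_nonneg_nonneg sum_nonneg) auto

lemma has_derivative_Gamma_w:
  assumes u: "heat_flow u" and x: "x \<in> cube n"
  shows "((\<lambda>r. Gamma_w n q w (u r) x) has_real_derivative
      2 * Gamma_bi n q w (u t) (gen n q (u t)) x) (at t)"
proof -
  have "((\<lambda>r. \<Sum>i\<in>{1..n}. w i x * q i x * (u r (flip x i) - u r x)\<^sup>2) has_real_derivative
     (\<Sum>i\<in>{1..n}. w i x * q i x * (2 * (u t (flip x i) - u t x)
        * (gen n q (u t) (flip x i) - gen n q (u t) x)))) (at t)"
  proof (intro DERIV_sum DERIV_cmult)
    fix i assume i: "i \<in> {1..n}"
    have "((\<lambda>r. u r (flip x i) - u r x) has_real_derivative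
        gen n q (u t) (flip x i) - gen n q (u t) x) (at t)"
      by (intro DERIV_diff heat_flow_deriv [OF u] flip_in_cube i x)
    from DERIV_power [OF this, of 2]
    show "((\<lambda>r. (u r (flip x i) - u r x)\<^sup>2) has_real_derivative 2 * (u t (flip x i) - u t x)
        * (gen n q (u t) (flip x i) - gen n q (u t) x)) (at t)"
      by (rule DERIV_cong) (simp add: algebra_simps)
  qed
  from DERIV_cmult [OF this, of "1/2"] show ?thesis
    unfolding Gamma_w_eq
    by (rule DERIV_cong) (simp add: Gamma_bi_def sum_distrib_left algebra_simps)
qed

text \<open>
  With \<open>k\<^sub>r = \<surd>(\<Gamma>\<^sub>w (u\<^sub>r))\<close> the identity \<open>L (k\<^sup>2) = 2 k L k + 2 \<Gamma>(k)\<close> turns the reinforced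
  Bakry-Emery condition into \<open>k' \<le> L k - \<rho> k\<close> wherever \<open>k > 0\<close>; the term \<open>\<Gamma>(\<surd>(\<Gamma>\<^sub>w))\<close> is exactly what
  the square root costs. Hence \<open>exp (\<rho> r) k\<^sub>r\<close> is a subsolution of the heat equation, and \<open>v\<close> is the
  solution with the same initial value.
\<close>

lemma gradient_bound_of_reinforced_BE:
  assumes rBE: "reinforced_BE n q w \<rho>"
    and w: "\<And>i x. i \<in> {1..n} \<Longrightarrow> x \<in> cube n \<Longrightarrow> 0 \<le> w i x"
    and u: "heat_flow u" and v: "heat_flow v"
    and init: "\<And>x. x \<in> cube n \<Longrightarrow> v 0 x = sqrt (Gamma_w n q w (u 0) x)"
    and r: "0 \<le> r" and x: "x \<in> cube n"
  shows "sqrt (Gamma_w n q w (u r) x) \<le> exp (- \<rho> * r) * v r x"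
proof -
  define k where "k = (\<lambda>r x. sqrt (Gamma_w n q w (u r) x))"
  have knn: "0 \<le> k s y" if "y \<in> cube n" for s y
    unfolding k_def using Gamma_w_nonneg [of w y] w that by simp
  have ksq: "(k s y)\<^sup>2 = Gamma_w n q w (u s) y" if "y \<in> cube n" for s y
    unfolding k_def using Gamma_w_nonneg [of w y] w that by simp
  have vnn: "0 \<le> v s y" if "0 \<le> s" "y \<in> cube n" for s y
    by (rule heat_flow_pos [OF v _ that]) (use init knn [of _ 0] in \<open>simp add: k_def\<close>)
  have main: "exp (\<rho> * r) * k r x \<le> v r x"
  proof (rule field_le_epsilon)
    fix e :: real assume e: "e > 0"
    define d where "d = e / (1 + r)"
    have d: "d > 0" using e r by (auto simp: d_def)
    have "exp (\<rho> * r) * k r x - v r x - d * (1 + r) < 0"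
    proof (rule first_crossing [OF finite_cube, where T = r
          and \<phi> = "\<lambda>s y. exp (\<rho> * s) * k s y - v s y - d * (1 + s)"])
      fix y assume y: "y \<in> cube n"
      show "continuous_on {0..r} (\<lambda>s. exp (\<rho> * s) * k s y - v s y - d * (1 + s))"
        unfolding k_def
        using DERIV_continuous_on [of "{0..r}", OF has_field_derivative_at_within
          [OF heat_flow_deriv [OF v y]]]
          DERIV_continuous_on [of "{0..r}", OF has_field_derivative_at_within
          [OF has_derivative_Gamma_w [OF u y]]]
        by (intro continuous_intros)
      show "exp (\<rho> * 0) * k 0 y - v 0 y - d * (1 + 0) < 0"
        using init [OF y] d by (simp add: k_def)
    next
      fix s y assume s: "0 < s" and y: "y \<in> cube n"
        and zero: "exp (\<rho> * s) * k s y - v s y - d * (1 + s) = 0"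
        and mx: "\<forall>z\<in>cube n. exp (\<rho> * s) * k s z - v s z - d * (1 + s) \<le> 0"
      let ?g = "Gamma_bi n q w (u s) (gen n q (u s)) y"
      (* The square root is not differentiable at zero, but a crossing can only happen where k is
         positive, because v is nonnegative. *)
      have "0 < v s y + d * (1 + s)" using vnn [of s y] y s d by (simp add: add_nonneg_pos)
      hence "0 < exp (\<rho> * s) * k s y" using zero by linarith
      hence kpos: "0 < k s y" by (simp add: zero_less_mult_iff)
      have Gpos: "0 < Gamma_w n q w (u s) y" using kpos unfolding k_def by simp
      have dk: "((\<lambda>t. k t y) has_real_derivative ?g / k s y) (at s)"
        unfolding k_def
        by (rule DERIV_cong [OF DERIV_chain2 [OF DERIV_real_sqrt [OF Gpos]
              has_derivative_Gamma_w [OF u y]]]) (simp add: field_simps)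
      have de: "((\<lambda>s. exp (\<rho> * s)) has_real_derivative exp (\<rho> * s) * \<rho>) (at s)"
        by (auto intro!: derivative_eq_intros)
      have dd: "((\<lambda>s. d * (1 + s)) has_real_derivative d) (at s)"
        by (auto intro!: derivative_eq_intros)
      note deriv = DERIV_diff [OF DERIV_diff [OF DERIV_mult [OF de dk] heat_flow_deriv [OF v y]] dd]
      have ks: "k s = (\<lambda>z. sqrt (Gamma_w n q w (u s) z))" by (simp add: k_def)
      have "\<rho> * (k s y)\<^sup>2 \<le> Gamma2_w n q w (u s) y - Gamma n q (k s) y"
        using rBE y unfolding reinforced_BE_def ksq [OF y] unfolding ks by blast
      moreover have "gen n q (Gamma_w n q w (u s)) y = gen n q (\<lambda>z. (k s z)\<^sup>2) y"
        by (rule gen_cong) (use ksq y in auto)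
      hence "Gamma2_w n q w (u s) y = k s y * gen n q (k s) y + Gamma n q (k s) y - ?g"
        unfolding Gamma2_w_def gen_square by simp
      ultimately have "?g \<le> (gen n q (k s) y - \<rho> * k s y) * k s y"
        by (simp add: power2_eq_square algebra_simps)
      hence g: "?g / k s y \<le> gen n q (k s) y - \<rho> * k s y"
        using kpos by (simp add: divide_le_eq)
      have "gen n q (\<lambda>z. exp (\<rho> * s) * k s z + 0 - v s z) y \<le> 0"
        using mx zero by (intro gen_nonpos_at_max [OF y]) force
      hence "exp (\<rho> * s) * gen n q (k s) y - gen n q (v s) y \<le> 0"
        unfolding gen_diff gen_affine .
      moreover have "exp (\<rho> * s) * (?g / k s y) \<le> exp (\<rho> * s) * (gen n q (k s) y - \<rho> * k s y)"
        using g by (rule mult_left_mono) simp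
      ultimately have "exp (\<rho> * s) * \<rho> * k s y + ?g / k s y * exp (\<rho> * s) - gen n q (v s) y - d < 0"
        using d by (simp add: algebra_simps)
      thus "\<exists>D<0. ((\<lambda>t. exp (\<rho> * t) * k t y - v t y - d * (1 + t)) has_real_derivative D) (at s)"
        using deriv by blast
    qed (use r x in auto)
    moreover have "d * (1 + r) = e" using r by (simp add: d_def)
    ultimately show "exp (\<rho> * r) * k r x \<le> v r x + e" by linarith
  qed
  have "k r x = exp (- \<rho> * r) * (exp (\<rho> * r) * k r x)"
    by (simp only: mult.assoc [symmetric] exp_add [symmetric]) simp
  also have "\<dots> \<le> exp (- \<rho> * r) * v r x" using main by (rule mult_left_mono) simp
  finally show ?thesis unfolding k_def .
qed

section \<open>The isoperimetric inequality\<close>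

text \<open>
  \<open>energy_drop_le\<close> with \<open>S (v + d)\<close> in place of \<open>v\<close>. The shift \<open>d\<close> provides strict positivity and
  tends to zero at the end. The scale \<open>S = \<surd>(t / b)\<close> is the one for which \<open>C t\<close> no longer depends
  on \<open>b\<close> and \<open>t\<close>, which balances the two terms of \<open>1 + C t\<close>.
\<close>

lemma energy_drop_le_surface_area:
  assumes w: "bounded_weights n b w" and b: "0 < b"
    and curv: "reinforced_BE n q w \<rho> \<or> strong_gradient_estimate n q w \<rho>"
    and \<kappa>: "\<kappa> = max 0 (- \<rho>)" and t: "0 < t"
    and bool: "\<And>x. x \<in> cube n \<Longrightarrow> f x \<in> {0, 1}"
  shows "mean (\<lambda>x. (semigroup_at n q 0 f x)\<^sup>2) - mean (\<lambda>x. (semigroup_at n q t f x)\<^sup>2)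
     \<le> (1 + (exp (\<kappa> * t))\<^sup>2) * sqrt (t / b) * surface_area n \<mu> q w f"
proof -
  define g where "g = (\<lambda>x. sqrt (Gamma_w n q w f x))"
  define u where "u = (\<lambda>r. semigroup_at n q r f)"
  define v where "v = (\<lambda>r. semigroup_at n q r g)"
  define S where "S = sqrt (t / b)"
  have S: "0 < S" "S\<^sup>2 = t / b" using t b by (auto simp: S_def)
  have wnn: "0 \<le> w i x" if "i \<in> {1..n}" "x \<in> cube n" for i x
    using w b that unfolding bounded_weights_def by fastforce
  have u: "heat_flow u" and v: "heat_flow v" unfolding u_def v_def by (rule heat_flow_semigroup)+
  have u0: "u 0 = f" and v0: "v 0 = g" unfolding u_def v_def by (rule semigroup_at_0)+
  have g0: "0 \<le> g x" if "x \<in> cube n" for x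
    unfolding g_def using Gamma_w_nonneg [of w x] wnn that by simp
  have u01: "0 \<le> u r x \<and> u r x \<le> 1" if r: "0 \<le> r" and x: "x \<in> cube n" for r x
  proof
    show "0 \<le> u r x" by (rule heat_flow_pos [OF u _ r x]) (use bool u0 in force)
    have "0 \<le> (- 1) * u r x + 1"
      by (rule heat_flow_pos [OF heat_flow_affine [OF u] _ r x]) (use bool u0 in force)
    thus "u r x \<le> 1" by simp
  qed
  have v_nn: "0 \<le> v r x" if r: "0 \<le> r" and x: "x \<in> cube n" for r x
    by (rule heat_flow_pos [OF v _ r x]) (use g0 v0 in auto)
  have grad: "sqrt (Gamma_w n q w (u r) x) \<le> exp (\<kappa> * t) * v r x"
    if r: "0 \<le> r" "r \<le> t" and x: "x \<in> cube n" for r x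
  proof -
    have "sqrt (Gamma_w n q w (u r) x) \<le> exp (- \<rho> * r) * v r x"
      using curv
    proof
      assume "reinforced_BE n q w \<rho>"
      thus ?thesis by (rule gradient_bound_of_reinforced_BE [OF _ wnn u v _ r(1) x])
          (auto simp: u0 v0 g_def)
    next
      assume "strong_gradient_estimate n q w \<rho>"
      thus ?thesis using r(1) x unfolding strong_gradient_estimate_def u_def v_def g_def by blast
    qed
    also have "- \<rho> * r \<le> \<kappa> * t"
    proof -
      have "- \<rho> * r \<le> \<kappa> * r" using r(1) \<kappa> by (intro mult_right_mono) auto
      also have "\<dots> \<le> \<kappa> * t" using r(2) \<kappa> by (intro mult_left_mono) auto
      finally show ?thesis .
    qed
    hence "exp (- \<rho> * r) * v r x \<le> exp (\<kappa> * t) * v r x"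
      using v_nn [OF r(1) x] by (intro mult_right_mono) auto
    finally show ?thesis .
  qed
  have Gamma_le: "b * Gamma n q h x \<le> Gamma_w n q w h x" if x: "x \<in> cube n" for h x
  proof -
    have "(\<Sum>i\<in>{1..n}. b * (q i x * (h (flip x i) - h x)\<^sup>2))
        \<le> (\<Sum>i\<in>{1..n}. w i x * (q i x * (h (flip x i) - h x)\<^sup>2))"
      using w x q_nonneg unfolding bounded_weights_def
      by (intro sum_mono mult_right_mono mult_nonneg_nonneg) auto
    moreover have "b * Gamma n q h x = 1/2 * (\<Sum>i\<in>{1..n}. b * (q i x * (h (flip x i) - h x)\<^sup>2))"
      unfolding Gamma_eq by (simp add: sum_distrib_left [symmetric])
    ultimately show ?thesis unfolding Gamma_w_eq mult.assoc by linarith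
  qed
  have step: "mean (\<lambda>x. (u 0 x)\<^sup>2) - mean (\<lambda>x. (u t x)\<^sup>2)
      \<le> (1 + (exp (\<kappa> * t))\<^sup>2) * (S * (mean g + d))" if d: "0 < d" for d
  proof -
    define v' where "v' = (\<lambda>r x. S * v r x + S * d)"
    define c where "c = (exp (\<kappa> * t))\<^sup>2 / t"
    have "mean (\<lambda>x. (u 0 x)\<^sup>2) - mean (\<lambda>x. (u t x)\<^sup>2) \<le> (1 + c * t) * mean (v' 0)"
    proof (rule energy_drop_le [OF u])
      show "heat_flow v'" unfolding v'_def by (rule heat_flow_affine [OF v])
      show "0 \<le> c" using t by (simp add: c_def)
      show "0 < v' r x" if "0 \<le> r" "x \<in> cube n" for r x
        unfolding v'_def using v_nn [OF that] S d by (simp add: add_nonneg_pos)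
      show "u 0 x \<in> {0, 1}" if "x \<in> cube n" for x using bool [OF that] by (simp add: u0)
      show "Gamma n q (u r) x \<le> c * (v' r x)\<^sup>2" if r: "0 \<le> r" "r \<le> t" and x: "x \<in> cube n" for r x
      proof -
        have "Gamma_w n q w (u r) x = (sqrt (Gamma_w n q w (u r) x))\<^sup>2"
          using Gamma_w_nonneg [of w x] wnn x by simp
        also have "\<dots> \<le> (exp (\<kappa> * t) * v r x)\<^sup>2"
          using grad [OF r x] Gamma_w_nonneg [of w x] wnn x by (intro power_mono) auto
        also have "\<dots> \<le> (exp (\<kappa> * t) * (v r x + d))\<^sup>2"
          using v_nn [OF r(1) x] d by (intro power_mono mult_left_mono) auto
        finally have "b * Gamma n q (u r) x \<le> (exp (\<kappa> * t))\<^sup>2 * (v r x + d)\<^sup>2"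
          using Gamma_le [OF x, of "u r"] by (simp add: power_mult_distrib)
        hence "Gamma n q (u r) x \<le> (exp (\<kappa> * t))\<^sup>2 * (v r x + d)\<^sup>2 / b"
          using b by (simp add: field_simps)
        also have "\<dots> = c * (S\<^sup>2 * (v r x + d)\<^sup>2)" unfolding c_def S(2) using t by simp
        also have "\<dots> = c * (v' r x)\<^sup>2" unfolding v'_def
          by (simp add: power_mult_distrib [symmetric] distrib_left)
        finally show ?thesis .
      qed
    qed (use u01 t in auto)
    also have "c * t = (exp (\<kappa> * t))\<^sup>2" using t by (simp add: c_def)
    also have "mean (v' 0) = S * (mean g + d)"
      unfolding v'_def v0 mean_add mean_cmult mean_const by (simp add: distrib_left)
    finally show ?thesis .
  qed
  have "mean (\<lambda>x. (u 0 x)\<^sup>2) - mean (\<lambda>x. (u t x)\<^sup>2) \<le> (1 + (exp (\<kappa> * t))\<^sup>2) * (S * mean g)"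
  proof (rule field_le_epsilon)
    fix e :: real assume e: "0 < e"
    define k where "k = (1 + (exp (\<kappa> * t))\<^sup>2) * S"
    have k: "0 < k" unfolding k_def using S by (intro mult_pos_pos add_pos_nonneg) auto
    have "k * (mean g + e / k) = k * mean g + e" using k by (simp add: field_simps)
    thus "mean (\<lambda>x. (u 0 x)\<^sup>2) - mean (\<lambda>x. (u t x)\<^sup>2)
        \<le> (1 + (exp (\<kappa> * t))\<^sup>2) * (S * mean g) + e"
      using step [of "e / k"] e k unfolding k_def by (simp only: mult.assoc) simp
  qed
  thus ?thesis unfolding u_def S_def g_def surface_area_def expectation_eq_mean
    by (simp only: mult.assoc)
qed

text \<open>
  The two bounds on the energy drop are compared at \<open>t = 1 / (\<rho> l + \<kappa>)\<close>, the longest time, up to a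
  factor 2, with \<open>\<rho> t l \<le> 1\<close> and \<open>\<kappa> t \<le> 1\<close>. Since \<open>l \<ge> 1\<close>, \<open>\<rho> l + \<kappa> \<le> l (\<rho> + \<kappa>)\<close>, which
  leaves the factor \<open>\<surd>l\<close>. The constant is \<open>1 / (16 \<cdot> 10)\<close> with \<open>1 + e\<^sup>2 \<le> 10\<close>.
\<close>

theorem surface_area_ge:
  assumes w: "bounded_weights n b w" and b: "0 < b"
    and curv: "reinforced_BE n q w \<rho>' \<or> strong_gradient_estimate n q w \<rho>'"
    and \<rho>: "0 < \<rho>" and lsi: "log_Sobolev n \<mu> q \<rho>"
    and bool: "\<And>x. x \<in> cube n \<Longrightarrow> f x \<in> {0, 1}"
  shows "1 / 160 * (sqrt b * \<rho> / sqrt (\<rho> + max 0 (- \<rho>')))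
            * measure_pmf.variance \<mu> f * sqrt (ln (exp 1 / measure_pmf.variance \<mu> f))
         \<le> surface_area n \<mu> q w f"
proof -
  define a where "a = mean f"
  define V where "V = a * (1 - a)"
  define A where "A = surface_area n \<mu> q w f"
  define \<kappa> where "\<kappa> = max 0 (- \<rho>')"
  have \<kappa>0: "0 \<le> \<kappa>" by (simp add: \<kappa>_def)
  have wnn: "0 \<le> w i x" if "i \<in> {1..n}" "x \<in> cube n" for i x
    using w b that unfolding bounded_weights_def by fastforce
  have A0: "0 \<le> A" unfolding A_def surface_area_def expectation_eq_mean
    using Gamma_w_nonneg wnn by (intro mean_nonneg) auto
  have var: "measure_pmf.variance \<mu> f = V"
  proof -
    have "measure_pmf.variance \<mu> f = mean (\<lambda>x. (f x - a)\<^sup>2)"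
      unfolding expectation_eq_mean a_def ..
    also have "\<dots> = mean (\<lambda>x. (1 - 2 * a) * f x + a\<^sup>2)"
      using bool by (intro mean_cong) (force simp: power2_eq_square algebra_simps)
    also have "\<dots> = V" unfolding mean_add mean_cmult mean_const a_def [symmetric] V_def
      by (simp add: power2_eq_square algebra_simps)
    finally show ?thesis .
  qed
  have "0 \<le> a" unfolding a_def by (rule mean_nonneg) (use bool in force)
  moreover have "a \<le> mean (\<lambda>_. 1)" unfolding a_def by (rule mean_mono) (use bool in force)
  ultimately have a01: "0 \<le> a" "a \<le> 1" unfolding mean_const by auto
  show ?thesis
  proof (cases "V = 0")
    case True
    thus ?thesis unfolding var using A0 by (simp add: A_def)
  next
    case False
    hence a: "0 < a" "a < 1" using a01 unfolding V_def by (auto simp: less_le)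
    have Vpos: "0 < V" using a by (simp add: V_def)
    define l where "l = ln (exp 1 / V)"
    have "V \<le> 1" unfolding V_def using a01 mult_le_one [of a "1 - a"] by simp
    hence "ln (exp 1) \<le> l" unfolding l_def using Vpos
      by (subst ln_le_cancel_iff) (auto simp: le_divide_eq)
    hence l1: "1 \<le> l" by simp
    define M where "M = \<rho> * l + \<kappa>"
    have \<rho>l: "0 < \<rho> * l" using \<rho> l1 by simp
    have M: "0 < M" unfolding M_def using \<rho>l \<kappa>0 by simp
    define t where "t = 1 / M"
    have t: "0 < t" using M by (simp add: t_def)
    have tl: "\<rho> * t * l \<le> 1" using M \<kappa>0 by (simp add: t_def M_def)
    have \<kappa>t: "\<kappa> * t \<le> 1" using M \<rho>l by (simp add: t_def M_def)
    have "V * (\<rho> * t * l / 16) \<le> mean (\<lambda>x. (semigroup_at n q 0 f x)\<^sup>2) - mean (\<lambda>x. (semigroup_at n q t f x)\<^sup>2)"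
      unfolding V_def
    proof (rule energy_drop_ge [OF lsi \<rho> heat_flow_semigroup _ _ _ _ a _ tl])
      fix r :: real and x assume r: "0 \<le> r" and x: "x \<in> cube n"
      have "0 \<le> semigroup_at n q r f x"
        by (rule heat_flow_pos [OF heat_flow_semigroup _ r x]) (use bool semigroup_at_0 in force)
      moreover have "0 \<le> (- 1) * semigroup_at n q r f x + 1"
        by (rule heat_flow_pos [OF heat_flow_affine [OF heat_flow_semigroup] _ r x])
          (use bool semigroup_at_0 in force)
      ultimately show "0 \<le> semigroup_at n q r f x \<and> semigroup_at n q r f x \<le> 1" by simp
    qed (use t bool in \<open>auto simp: semigroup_at_0 a_def l_def V_def\<close>)
    also have "\<dots> \<le> (1 + (exp (\<kappa> * t))\<^sup>2) * sqrt (t / b) * A"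
      unfolding A_def by (rule energy_drop_le_surface_area [OF w b curv \<kappa>_def t bool])
    also have "\<dots> \<le> 10 * sqrt (t / b) * A"
    proof (intro mult_right_mono)
      have "exp (\<kappa> * t) \<le> exp 1" using \<kappa>t by simp
      also have "\<dots> \<le> 3" by (rule exp_le)
      finally have "(exp (\<kappa> * t))\<^sup>2 \<le> 3\<^sup>2" by (intro power_mono) auto
      thus "1 + (exp (\<kappa> * t))\<^sup>2 \<le> 10" by simp
    qed (use A0 t b in auto)
    finally have "V * (\<rho> * t * l / 16) \<le> 10 * sqrt (t / b) * A" .
    hence "V * (\<rho> * t * l / 16) * (sqrt b / sqrt t) \<le> 10 * sqrt (t / b) * A * (sqrt b / sqrt t)"
      using t b by (intro mult_right_mono) auto
    also have "\<dots> = 10 * A" using t b by (simp add: real_sqrt_divide)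
    also have "V * (\<rho> * t * l / 16) * (sqrt b / sqrt t) = V * \<rho> * l * sqrt b * (t / sqrt t) / 16"
      by (simp add: mult_ac)
    also have "t / sqrt t = 1 / sqrt M" using M by (simp add: t_def real_sqrt_divide real_div_sqrt field_simps)
    finally have "V * \<rho> * l * sqrt b * (1 / sqrt M) / 16 \<le> 10 * A" .
    moreover have "X \<le> 160 * A" if "X / 16 \<le> 10 * A" for X :: real using that by simp
    ultimately have "V * \<rho> * l * sqrt b * (1 / sqrt M) \<le> 160 * A" by blast
    hence key: "V * \<rho> * l * sqrt b / sqrt M \<le> 160 * A" by simp
    have sl: "l = sqrt l * sqrt l" using l1 by simp
    have "sqrt M \<le> sqrt (l * (\<rho> + \<kappa>))"
      using mult_right_mono [OF l1 \<kappa>0] by (simp add: M_def algebra_simps)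
    hence "V * \<rho> * l * sqrt b / sqrt (l * (\<rho> + \<kappa>)) \<le> V * \<rho> * l * sqrt b / sqrt M"
      using M Vpos \<rho> l1 b by (intro divide_left_mono) (auto simp: \<kappa>0 add_pos_nonneg)
    also have "V * \<rho> * l * sqrt b / sqrt (l * (\<rho> + \<kappa>)) = sqrt b * \<rho> / sqrt (\<rho> + \<kappa>) * V * sqrt l"
    proof -
      have "V * \<rho> * (z * z) * B / (z * R) = B * \<rho> / R * V * z" if "0 < z" for z B R :: real
        using that by (simp add: mult_ac)
      from this [of "sqrt l" "sqrt b" "sqrt (\<rho> + \<kappa>)"] show ?thesis
        using l1 unfolding real_sqrt_mult sl [symmetric] by simp
    qed
    also note key
    finally have le: "sqrt b * \<rho> / sqrt (\<rho> + \<kappa>) * V * sqrt l \<le> 160 * A" .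
    have "1 / 160 * X * V * s \<le> A" if "X * V * s \<le> 160 * A" for X s :: real using that by simp
    from this [OF le] show ?thesis
      unfolding var l_def [symmetric] \<kappa>_def [symmetric] A_def [symmetric] .
  qed
qed

end

theorem corollary5p2:
  shows "\<exists>c>0. \<forall>(n::nat) (\<mu> :: (nat \<Rightarrow> int) pmf)
            (q :: nat \<Rightarrow> (nat \<Rightarrow> int) \<Rightarrow> real) (w :: nat \<Rightarrow> (nat \<Rightarrow> int) \<Rightarrow> real)
            (b::real) (\<rho>_rBE::real) (\<rho>_LSI::real).
     set_pmf \<mu> \<subseteq> cube n \<longrightarrow> transition_rates n q \<longrightarrow> reversible n \<mu> q \<longrightarrow>
     0 < b \<longrightarrow> b \<le> 1 \<longrightarrow> bounded_weights n b w \<longrightarrow>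
     (reinforced_BE n q w \<rho>_rBE \<or> strong_gradient_estimate n q w \<rho>_rBE) \<longrightarrow>
     0 < \<rho>_LSI \<longrightarrow> log_Sobolev n \<mu> q \<rho>_LSI \<longrightarrow>
     (\<forall>f. (\<forall>x\<in>cube n. f x \<in> {0, 1}) \<longrightarrow>
        surface_area n \<mu> q w f \<ge>
          c * (sqrt b * \<rho>_LSI / sqrt (\<rho>_LSI + max 0 (- \<rho>_rBE)))
            * measure_pmf.variance \<mu> f
            * sqrt (ln (exp 1 / measure_pmf.variance \<mu> f)))"
  using cube_chain.surface_area_ge [OF cube_chain.intro]
  by (intro exI [of _ "1 / 160"] conjI allI impI) (simp, blast)

end
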